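(* Let $(\mathcal A,\mathcal C,E,\alpha^* )$ be a covariant positive flow with phase space $X$ and (finite) spectral potential $\lambda$. Suppose $\lambda$ is Gâteaux differentiable at a point $\varphi\in C(X)$, with derivative $\mu=\lambda'(\varphi)$, and let $\nu$ be a $\varphi$-sensitive state. Then for all functions $f\in C(X)$ the law of large numbers $$\lim_{n\to\infty}P_n\bigl\{x\in X\bigm| |\delta_{x,n}(f)-\mu(f)|>\varepsilon\bigr\}=0\quad\text{for all }\varepsilon>0$$ holds, where $P_n=\nu(\,\cdot\,E_\varphi^n)/\nu(E_\varphi^n)$; and if, in addition, $\nu$ is a right eigen-state for $E_\varphi$, then for all $f\in C(X)$ the strong law of large numbers $$\lim_{n\to\infty}\delta_{x,n}(f)=\mu(f)\quad\text{for }\nu\text{-almost all }x\in X$$ holds.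
   Context: All algebras are real and associative. A cone in a real vector space is a convex subset $K$ with $tK\subset K$ for $t\ge0$ and such that $v,-v\in K$ imply $v=0$; $u\le v$ means $v-u\in K$. A positive algebra is a real normed algebra $\mathcal A$ ($\|ab\|\le\|a\|\|b\|$) with unit $I$, $\|I\|=1$, and a cone $\mathcal A_+$ closed under products and containing $I$, whose norm is monotone: $\|u\|\le\|u+v\|$ for $u,v\in\mathcal A_+$. A phase subalgebra $\mathcal C\subset\mathcal A$ is a commutative subalgebra containing $I$ such that each $a\in\mathcal C$ satisfies $-tI\le a\le tI$ for some $t>0$. If $\mathcal A_+$ is closed, there is a Hausdorff compact set $X$, unique up to homeomorphism (the phase space), such that $\mathcal C$ is isomorphic, including the order, to a dense subalgebra of $C(X)$ (real continuous functions, supremum norm); $\mathcal C$ is identified with this subalgebra. When $\mathcal A$ is moreover complete, the inclusion $\mathcal C\to\mathcal A$ extends uniquely to a continuous, injective, positive homomorphism $C(X)\to\mathcal A$, by which $C(X)$ is regarded as a subalgebra of $\mathcal A$. A covariant positive flow $(\mathcal A,\mathcal C,E,\alpha^* )$ consists of a positive algebra $\mathcal A$, complete in norm, with closed cone $\mathcal A_+$; a phase subalgebra $\mathcal C$ with phase space $X$; an element $E\in\mathcal A_+$; and a positive unital homomorphism $\alpha^*:\mathcal C\to\mathcal C$ with $Ef=\alpha^*(f)E$ for all $f\in\mathcal C$. There is a unique continuous $\alpha:X\to X$ with $\alpha^*(f)=f\circ\alpha$. For $\varphi\in C(X)$ put $E_\varphi=e^\varphi E$. The spectral potential is $\lambda(\varphi)=\lim_{n\to\infty}\frac1n\ln\|E_\varphi^n\|$;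 standing assumption: $\lambda$ is finite on $C(X)$ (otherwise $\lambda\equiv-\infty$). A state is a positive continuous linear functional $\nu$ on $\mathcal A$; its restriction to $C(X)$ is identified with a (regular) Borel measure on $X$ via the Riesz theorem, also denoted $\nu$. A state $\nu$ is $\varphi$-sensitive if $\lim_{n\to\infty}\frac1n\ln\nu(E_\varphi^n)=\lambda(\varphi)$. It is a right eigen-state for $E_\varphi$ if $\nu(AE_\varphi)=e^{\lambda(\varphi)}\nu(A)$ for all $A\in\mathcal A$. $P_n$ is the Borel probability measure on $X$ given by $P_n(g)=\nu(gE_\varphi^n)/\nu(E_\varphi^n)$, $g\in C(X)$ (defined for all sufficiently large $n$). Empirical measures: $\delta_{x,n}(f)=\frac1n\sum_{i=0}^{n-1}f(\alpha^i(x))$. The Gâteaux derivative $\lambda'(\varphi)$ is the continuous linear functional $\mu\in C^*(X)$ with $\frac{d}{dt}\lambda(\varphi+tf)|_{t=0}=\mu(f)$ for all $f\in C(X)$. *)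

theory Defs
  imports "HOL-Analysis.Analysis"
begin

section \<open>The Banach algebra of continuous functions on a compact space\<close>

text \<open>On a compact space every real continuous function is bounded, so \<open>'x \<Rightarrow>\<^sub>C real\<close> is then
  $C(X)$ with the supremum norm. The library provides its normed space structure; the pointwise
  product is added here.\<close>

instantiation bcontfun :: (topological_space, real_normed_algebra_1) real_normed_algebra_1
begin

definition times_bcontfun ::
    "('a \<Rightarrow>\<^sub>C 'b) \<Rightarrow> ('a \<Rightarrow>\<^sub>C 'b) \<Rightarrow> ('a \<Rightarrow>\<^sub>C 'b)" where
  "f * g = Bcontfun (\<lambda>x. apply_bcontfun f x * apply_bcontfun g x)"

definition one_bcontfun :: "'a \<Rightarrow>\<^sub>C 'b" where
  "1 = const_bcontfun 1"

lemma apply_bcontfun_times [simp]: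
  "apply_bcontfun (f * g) x = apply_bcontfun f x * apply_bcontfun g x"
  for f g :: "'a \<Rightarrow>\<^sub>C 'b"
proof -
  have "(\<lambda>x. apply_bcontfun f x * apply_bcontfun g x) \<in> bcontfun"
  proof (rule bcontfun_normI)
    show "continuous_on UNIV (\<lambda>x. apply_bcontfun f x * apply_bcontfun g x)"
      by (intro continuous_intros) auto
    show "norm (apply_bcontfun f x * apply_bcontfun g x) \<le> norm f * norm g" for x
      by (rule order_trans[OF norm_mult_ineq]) (intro mult_mono norm_bounded norm_ge_zero)
  qed
  then show ?thesis
    by (simp add: times_bcontfun_def Bcontfun_inverse)
qed

lemma apply_bcontfun_one [simp]: "apply_bcontfun (1 :: 'a \<Rightarrow>\<^sub>C 'b) x = 1"
  by (simp add: one_bcontfun_def)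

instance
proof
  fix f g h :: "'a \<Rightarrow>\<^sub>C 'b" and r :: real
  show "f * g * h = f * (g * h)" by (rule bcontfun_eqI) (simp add: mult.assoc)
  show "(f + g) * h = f * h + g * h" by (rule bcontfun_eqI) (simp add: distrib_right)
  show "f * (g + h) = f * g + f * h" by (rule bcontfun_eqI) (simp add: distrib_left)
  show "r *\<^sub>R f * g = r *\<^sub>R (f * g)" by (rule bcontfun_eqI) simp
  show "f * r *\<^sub>R g = r *\<^sub>R (f * g)" by (rule bcontfun_eqI) simp
  show "1 * f = f" by (rule bcontfun_eqI) simp
  show "f * 1 = f" by (rule bcontfun_eqI) simp
  show "(0 :: 'a \<Rightarrow>\<^sub>C 'b) \<noteq> 1"
  proof
    assume "(0 :: 'a \<Rightarrow>\<^sub>C 'b) = 1"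
    then have "apply_bcontfun (0 :: 'a \<Rightarrow>\<^sub>C 'b) undefined = apply_bcontfun 1 undefined" by simp
    then show False by simp
  qed
  show "norm (f * g) \<le> norm f * norm g"
    by (rule norm_bound, simp, rule order_trans[OF norm_mult_ineq])
       (intro mult_mono norm_bounded norm_ge_zero)
  show "norm (1 :: 'a \<Rightarrow>\<^sub>C 'b) = 1"
  proof (rule antisym)
    show "norm (1 :: 'a \<Rightarrow>\<^sub>C 'b) \<le> 1" by (rule norm_bound) simp
    show "1 \<le> norm (1 :: 'a \<Rightarrow>\<^sub>C 'b)"
      using norm_bounded[of "1 :: 'a \<Rightarrow>\<^sub>C 'b" undefined] by simp
  qed
qed

end

definition exp_bcontfun :: "('x::topological_space \<Rightarrow>\<^sub>C real) \<Rightarrow> ('x \<Rightarrow>\<^sub>C real)" where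
  "exp_bcontfun \<phi> = Bcontfun (\<lambda>x. exp (apply_bcontfun \<phi> x))"

lemma apply_exp_bcontfun [simp]:
  "apply_bcontfun (exp_bcontfun \<phi>) x = exp (apply_bcontfun \<phi> x)"
proof -
  have "(\<lambda>x. exp (apply_bcontfun \<phi> x)) \<in> bcontfun"
  proof (rule bcontfun_normI)
    show "continuous_on UNIV (\<lambda>x. exp (apply_bcontfun \<phi> x))"
      by (intro continuous_intros) auto
    show "norm (exp (apply_bcontfun \<phi> x)) \<le> exp (norm \<phi>)" for x
      using norm_bounded[of \<phi> x] by simp
  qed
  then show ?thesis
    by (simp add: exp_bcontfun_def Bcontfun_inverse)
qed


section \<open>Positive algebras, phase subalgebras and covariant positive flows\<close>

text \<open>\<open>\<A>\<close> is the whole type \<open>'a\<close> and \<open>P\<close> is the cone $\mathcal A_+$; the class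
  \<open>real_normed_algebra_1\<close> contains submultiplicativity of the norm and \<open>norm 1 = 1\<close>. The order
  $u \le v$ is always written \<open>v - u \<in> P\<close>.\<close>

locale positive_algebra =
  fixes P :: "'a::real_normed_algebra_1 set"
  assumes convex_P: "convex P"
    and cone_P: "cone P"
    and pointed_P: "\<And>v. v \<in> P \<Longrightarrow> - v \<in> P \<Longrightarrow> v = 0"
    and mult_P: "\<And>u v. u \<in> P \<Longrightarrow> v \<in> P \<Longrightarrow> u * v \<in> P"
    and one_P: "1 \<in> P"
    and norm_mono_P: "\<And>u v. u \<in> P \<Longrightarrow> v \<in> P \<Longrightarrow> norm u \<le> norm (u + v)"

locale phase_subalgebra = positive_algebra P
  for P :: "'a::real_normed_algebra_1 set" +
  fixes C :: "'a set"
  assumes subspace_C: "subspace C"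
    and mult_C: "\<And>a b. a \<in> C \<Longrightarrow> b \<in> C \<Longrightarrow> a * b \<in> C"
    and commute_C: "\<And>a b. a \<in> C \<Longrightarrow> b \<in> C \<Longrightarrow> a * b = b * a"
    and one_C: "1 \<in> C"
    and order_unit_C: "\<And>a. a \<in> C \<Longrightarrow> \<exists>t>0. a - (- (t *\<^sub>R 1)) \<in> P \<and> t *\<^sub>R 1 - a \<in> P"

locale covariant_positive_flow = phase_subalgebra P C
  for P :: "'a::{real_normed_algebra_1, banach} set" and C :: "'a set" +
  fixes E :: 'a and \<alpha>s :: "'a \<Rightarrow> 'a"
  assumes closed_P: "closed P"
    and E_P: "E \<in> P"
    and \<alpha>s_C: "\<And>a. a \<in> C \<Longrightarrow> \<alpha>s a \<in> C"
    and \<alpha>s_add: "\<And>a b. a \<in> C \<Longrightarrow> b \<in> C \<Longrightarrow> \<alpha>s (a + b) = \<alpha>s a + \<alpha>s b"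
    and \<alpha>s_scaleR: "\<And>r a. a \<in> C \<Longrightarrow> \<alpha>s (r *\<^sub>R a) = r *\<^sub>R \<alpha>s a"
    and \<alpha>s_mult: "\<And>a b. a \<in> C \<Longrightarrow> b \<in> C \<Longrightarrow> \<alpha>s (a * b) = \<alpha>s a * \<alpha>s b"
    and \<alpha>s_one: "\<alpha>s 1 = 1"
    and \<alpha>s_pos: "\<And>a. a \<in> C \<Longrightarrow> a \<in> P \<Longrightarrow> \<alpha>s a \<in> P"
    and covariance: "\<And>a. a \<in> C \<Longrightarrow> E * a = \<alpha>s a * E"

text \<open>The phase space is the type \<open>'x\<close>, and \<open>\<iota>\<close> identifies \<open>C\<close>, including its order, with a dense
  subalgebra of $C(X)$.\<close>

locale phase_space = phase_subalgebra P C
  for P :: "'a::real_normed_algebra_1 set" and C :: "'a set" +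
  fixes \<iota> :: "'a \<Rightarrow> ('x::t2_space \<Rightarrow>\<^sub>C real)"
  assumes compact_X: "compact (UNIV :: 'x set)"
    and \<iota>_add: "\<And>a b. a \<in> C \<Longrightarrow> b \<in> C \<Longrightarrow> \<iota> (a + b) = \<iota> a + \<iota> b"
    and \<iota>_scaleR: "\<And>r a. a \<in> C \<Longrightarrow> \<iota> (r *\<^sub>R a) = r *\<^sub>R \<iota> a"
    and \<iota>_mult: "\<And>a b. a \<in> C \<Longrightarrow> b \<in> C \<Longrightarrow> \<iota> (a * b) = \<iota> a * \<iota> b"
    and \<iota>_one: "\<iota> 1 = 1"
    and \<iota>_inj: "inj_on \<iota> C"
    and \<iota>_order: "\<And>a b. a \<in> C \<Longrightarrow> b \<in> C \<Longrightarrow>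
      b - a \<in> P \<longleftrightarrow> (\<forall>x. apply_bcontfun (\<iota> a) x \<le> apply_bcontfun (\<iota> b) x)"
    and \<iota>_dense: "closure (\<iota> ` C) = UNIV"

text \<open>\<open>J\<close> is the continuous injective positive homomorphism $C(X) \to \mathcal A$ extending the
  inclusion of \<open>C\<close>, and \<open>\<alpha>\<close> is the continuous map with $\alpha^*(f) = f \circ \alpha$. Both exist and
  are uniquely determined by the conditions listed, so quantifying over all \<open>J\<close> and \<open>\<alpha>\<close> satisfying
  them amounts to speaking of these two maps.\<close>

locale phase_space_flow =
  covariant_positive_flow P C E \<alpha>s + phase_space P C \<iota>
  for P :: "'a::{real_normed_algebra_1, banach} set" and C :: "'a set"
    and E :: 'a and \<alpha>s :: "'a \<Rightarrow> 'a"
    and \<iota> :: "'a \<Rightarrow> ('x::t2_space \<Rightarrow>\<^sub>C real)" +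
  fixes J :: "('x \<Rightarrow>\<^sub>C real) \<Rightarrow> 'a" and \<alpha> :: "'x \<Rightarrow> 'x"
  assumes J_bounded_linear: "bounded_linear J"
    and J_mult: "\<And>f g. J (f * g) = J f * J g"
    and J_inj: "inj J"
    and J_pos: "\<And>f. (\<And>x. 0 \<le> apply_bcontfun f x) \<Longrightarrow> J f \<in> P"
    and J_extends: "\<And>a. a \<in> C \<Longrightarrow> J (\<iota> a) = a"
    and \<alpha>_continuous: "continuous_on UNIV \<alpha>"
    and \<alpha>_dual: "\<And>a x. a \<in> C \<Longrightarrow>
      apply_bcontfun (\<iota> (\<alpha>s a)) x = apply_bcontfun (\<iota> a) (\<alpha> x)"


section \<open>Spectral potential\<close>

definition weighted ::
    "(('x::topological_space \<Rightarrow>\<^sub>C real) \<Rightarrow> 'a::real_normed_algebra_1) \<Rightarrow> 'a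
      \<Rightarrow> ('x \<Rightarrow>\<^sub>C real) \<Rightarrow> 'a" where
  "weighted J E \<phi> = J (exp_bcontfun \<phi>) * E"

text \<open>Logarithm with \<open>ln 0 = -\<infinity>\<close> (the real \<open>ln\<close> of the library has \<open>ln 0 = 0\<close>, which would hide the
  case of a spectral potential equal to \<open>-\<infinity>\<close>). It is only applied to nonnegative numbers.\<close>

definition eln :: "real \<Rightarrow> ereal" where
  "eln t = (if 0 < t then ereal (ln t) else - \<infinity>)"

definition spectral_potential ::
    "(('x::topological_space \<Rightarrow>\<^sub>C real) \<Rightarrow> 'a::real_normed_algebra_1) \<Rightarrow> 'a
      \<Rightarrow> ('x \<Rightarrow>\<^sub>C real) \<Rightarrow> ereal" where
  "spectral_potential J E \<phi> = lim (\<lambda>n. eln (norm (weighted J E \<phi> ^ n)) / ereal (real n))"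

definition has_gateaux_derivative ::
    "(('x::topological_space \<Rightarrow>\<^sub>C real) \<Rightarrow> real) \<Rightarrow> (('x \<Rightarrow>\<^sub>C real) \<Rightarrow> real)
      \<Rightarrow> ('x \<Rightarrow>\<^sub>C real) \<Rightarrow> bool" where
  "has_gateaux_derivative \<Lambda> \<mu> \<phi> \<longleftrightarrow>
    bounded_linear \<mu> \<and>
    (\<forall>f. ((\<lambda>t. \<Lambda> (\<phi> + t *\<^sub>R f)) has_real_derivative \<mu> f) (at 0))"


section \<open>States, measures on the phase space, empirical measures\<close>

definition state :: "'a::real_normed_algebra_1 set \<Rightarrow> ('a \<Rightarrow> real) \<Rightarrow> bool" where
  "state P \<nu> \<longleftrightarrow> bounded_linear \<nu> \<and> (\<forall>u\<in>P. 0 \<le> \<nu> u)"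

definition sensitive_state ::
    "(('x::topological_space \<Rightarrow>\<^sub>C real) \<Rightarrow> 'a::real_normed_algebra_1) \<Rightarrow> 'a \<Rightarrow> 'a set
      \<Rightarrow> ('x \<Rightarrow>\<^sub>C real) \<Rightarrow> ('a \<Rightarrow> real) \<Rightarrow> bool" where
  "sensitive_state J E P \<phi> \<nu> \<longleftrightarrow>
    state P \<nu> \<and>
    (\<lambda>n. eln (\<nu> (weighted J E \<phi> ^ n)) / ereal (real n)) \<longlonglongrightarrow> spectral_potential J E \<phi>"

definition right_eigen_state ::
    "(('x::topological_space \<Rightarrow>\<^sub>C real) \<Rightarrow> 'a::real_normed_algebra_1) \<Rightarrow> 'a \<Rightarrow> 'a set
      \<Rightarrow> ('x \<Rightarrow>\<^sub>C real) \<Rightarrow> ('a \<Rightarrow> real) \<Rightarrow> bool" where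
  "right_eigen_state J E P \<phi> \<nu> \<longleftrightarrow>
    state P \<nu> \<and>
    (\<forall>A. \<nu> (A * weighted J E \<phi>) = exp (real_of_ereal (spectral_potential J E \<phi>)) * \<nu> A)"

text \<open>\<open>M\<close> is the regular Borel measure that the Riesz theorem associates with the positive linear
  functional \<open>L\<close> on $C(X)$. For compact Hausdorff $X$ it exists and is unique; it is a probability
  measure if \<open>L 1 = 1\<close>.\<close>

definition riesz_measure ::
    "('x::t2_space) measure \<Rightarrow> (('x \<Rightarrow>\<^sub>C real) \<Rightarrow> real) \<Rightarrow> bool" where
  "riesz_measure M L \<longleftrightarrow>
    sets M = sets borel \<and> finite_measure M \<and>
    (\<forall>B\<in>sets borel. emeasure M B = (SUP K\<in>{K. compact K \<and> K \<subseteq> B}. emeasure M K)) \<and>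
    (\<forall>B\<in>sets borel. emeasure M B = (INF U\<in>{U. open U \<and> B \<subseteq> U}. emeasure M U)) \<and>
    (\<forall>g. (\<integral>x. apply_bcontfun g x \<partial>M) = L g)"

definition empirical ::
    "('x \<Rightarrow> 'x) \<Rightarrow> 'x \<Rightarrow> nat \<Rightarrow> ('x::topological_space \<Rightarrow>\<^sub>C real) \<Rightarrow> real" where
  "empirical \<alpha> x n f = (\<Sum>i<n. apply_bcontfun f ((\<alpha> ^^ i) x)) / real n"

end

theory Submission
  imports Defs
begin

text \<open>Covariance gives \<open>E\<^sub>\<phi>\<^sub>+\<^sub>f^n = exp (S\<^sub>n f) E\<^sub>\<phi>^n\<close> for the Birkhoff sum \<open>S\<^sub>n f\<close>, so that
  \<open>\<nu> (E\<^sub>\<phi>\<^sub>+\<^sub>t\<^sub>f^n) / \<nu> (E\<^sub>\<phi>^n)\<close> is the exponential moment of \<open>t S\<^sub>n f\<close> under \<open>P\<^sub>n\<close>. Its growth rate is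
  at most \<open>\<lambda> (\<phi> + t f) - \<lambda> \<phi> = t \<mu> f + o(t)\<close>, and Markov's inequality with a small \<open>t > 0\<close> makes the
  probability of \<open>S\<^sub>n f / n > \<mu> f + \<epsilon>\<close> decay exponentially; replacing \<open>f\<close> by \<open>- f\<close> controls the
  deviations below \<open>\<mu> f\<close>. For a right eigen-state every \<open>P\<^sub>n\<close> is \<open>\<nu>\<close> up to the factor \<open>\<nu> 1\<close>, so the
  exponential bounds are summable for the single measure \<open>\<nu>\<close> and the Borel--Cantelli lemma
  applies.\<close>

section \<open>Growth rates\<close>

text \<open>Division with remainder compares \<open>u n\<close> with multiples of \<open>u m\<close>
  for one fixed \<open>m\<close> whose quotient is already small; the error stays bounded and
  vanishes after division by \<open>n\<close>. The limit is taken in \<open>ereal\<close> because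
  the infimum may be \<open>- \<infinity>\<close>.\<close>

lemma fekete_subadditive:
  fixes u :: "nat \<Rightarrow> real"
  assumes sub: "\<And>m n. u (m + n) \<le> u m + u n"
  shows "(\<lambda>n. ereal (u n / real n)) \<longlonglongrightarrow> (INF m\<in>{1..}. ereal (u m / real m))"
proof (rule order_tendstoI)
  fix a assume "a < (INF m\<in>{1..}. ereal (u m / real m))"
  then have "a < ereal (u n / real n)" if "n \<ge> 1" for n
    using that by (meson INF_lower atLeast_iff less_le_trans)
  then show "\<forall>\<^sub>F n in sequentially. a < ereal (u n / real n)"
    unfolding eventually_sequentially by blast
next
  fix a assume "(INF m\<in>{1..}. ereal (u m / real m)) < a"
  then have "\<exists>m\<in>{1..}. ereal (u m / real m) < a"
    by (simp only: INF_less_iff)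
  then obtain m where m: "m \<ge> 1" "ereal (u m / real m) < a"
    unfolding Bex_def atLeast_iff by blast
  \<comment> \<open>Only remainders below \<open>m\<close> occur, so a maximum over finitely many
    values bounds their contribution.\<close>
  define B where "B = Max ((\<lambda>r. \<bar>u r\<bar>) ` {..<m})"
  have B: "u r \<le> B" if "r < m" for r
    unfolding B_def using that by (auto intro: order_trans[OF abs_ge_self Max_ge])
  have mult: "u (k * m + r) \<le> real k * u m + u r" for k r
  proof (induction k)
    case (Suc k)
    show ?case using sub[of m "k * m + r"] Suc by (simp add: algebra_simps)
  qed simp
  have bound: "u n / real n \<le> u m / real m + (\<bar>u m\<bar> + B) / real n" if "n \<ge> 1" for n
  proof -
    have n: "real n = real (n div m) * real m + real (n mod m)"
      by (metis div_mult_mod_eq of_nat_add of_nat_mult)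
    have r: "n mod m < m" using m by simp
    have "u n \<le> real (n div m) * u m + u (n mod m)"
      using mult[of "n div m" "n mod m"] by simp
    also have "real (n div m) * u m = real n * (u m / real m) - (real (n mod m) / real m) * u m"
      using m n by (simp add: field_simps)
    \<comment> \<open>The sign of \<open>u m\<close> is unknown, so the fractional part of
      \<open>n / m\<close> costs up to its absolute value.\<close>
    also have "\<dots> \<le> real n * (u m / real m) + \<bar>u m\<bar>"
    proof -
      have "\<bar>(real (n mod m) / real m) * u m\<bar> \<le> 1 * \<bar>u m\<bar>"
        unfolding abs_mult using r by (intro mult_right_mono) auto
      then show ?thesis by linarith
    qed
    finally have "u n \<le> real n * (u m / real m) + (\<bar>u m\<bar> + B)"
      using B[OF r] by linarith
    then show ?thesis using that by (simp add: field_simps)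
  qed
  have "(\<lambda>n. u m / real m + (\<bar>u m\<bar> + B) / real n) \<longlonglongrightarrow> u m / real m + 0"
    by (intro tendsto_intros lim_const_over_n)
  then have "(\<lambda>n. ereal (u m / real m + (\<bar>u m\<bar> + B) / real n)) \<longlonglongrightarrow> ereal (u m / real m)"
    by simp
  from order_tendstoD(2)[OF this m(2)]
  show "\<forall>\<^sub>F n in sequentially. ereal (u n / real n) < a"
    using eventually_ge_at_top[of 1]
  proof eventually_elim
    case (elim n)
    then have "ereal (u n / real n) \<le> ereal (u m / real m + (\<bar>u m\<bar> + B) / real n)"
      using bound[of n] by simp
    then show ?case using elim(1) by (rule le_less_trans)
  qed
qed

text \<open>The potential is defined through \<open>lim\<close>, which is informative only for
  convergent sequences. If \<open>a\<close> is nilpotent, the sequence is eventually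
  \<open>- \<infinity>\<close>; otherwise the logarithms are real and, by submultiplicativity of the
  norm, subadditive.\<close>

lemma convergent_eln_norm_power:
  fixes a :: "'a::real_normed_algebra_1"
  shows "convergent (\<lambda>n. eln (norm (a ^ n)) / ereal (real n))"
proof (cases "\<exists>m. a ^ m = 0")
  case True
  then obtain m where m: "a ^ m = 0" by blast
  have "\<forall>\<^sub>F n in sequentially. eln (norm (a ^ n)) / ereal (real n) = - \<infinity>"
    using eventually_ge_at_top[of "Suc m"]
  proof eventually_elim
    case (elim n)
    then have "a ^ n = a ^ m * a ^ (n - m)" by (simp flip: power_add)
    then show ?case using elim m by (simp add: eln_def)
  qed
  then show ?thesis
    by (intro convergentI tendsto_eventually)
next
  case False
  have "ln (norm (a ^ (m + n))) \<le> ln (norm (a ^ m)) + ln (norm (a ^ n))" for m n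
  proof -
    have "ln (norm (a ^ (m + n))) \<le> ln (norm (a ^ m) * norm (a ^ n))"
      using False norm_mult_ineq[of "a ^ m" "a ^ n"]
      by (subst ln_le_cancel_iff) (auto simp: power_add[symmetric])
    then show ?thesis using False by (simp add: ln_mult)
  qed
  from fekete_subadditive[of "\<lambda>n. ln (norm (a ^ n))", OF this]
  show ?thesis
  proof (rule convergentI[OF Lim_transform_eventually])
    show "\<forall>\<^sub>F n in sequentially.
        ereal (ln (norm (a ^ n)) / real n) = eln (norm (a ^ n)) / ereal (real n)"
      using eventually_gt_at_top[of 0] by eventually_elim (use False in \<open>simp add: eln_def\<close>)
  qed
qed

lemma spectral_potential_tendsto:
  "(\<lambda>n. eln (norm (weighted J E \<phi> ^ n)) / ereal (real n)) \<longlonglongrightarrow> spectral_potential J E \<phi>"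
  unfolding spectral_potential_def
  using convergent_eln_norm_power convergent_LIMSEQ_iff by blast

text \<open>A finite limit excludes the value \<open>- \<infinity>\<close> for large
  \<open>n\<close>, so positivity of \<open>v n\<close> comes out of the hypothesis. This later
  keeps the normalizing denominators away from zero.\<close>

lemma eln_rate_lower:
  assumes "(\<lambda>n. eln (v n) / ereal (real n)) \<longlonglongrightarrow> ereal l" and "\<delta> > 0"
  shows "\<forall>\<^sub>F n in sequentially. exp (real n * (l - \<delta>)) \<le> v n"
proof -
  have "ereal (l - \<delta>) < ereal l" using assms by simp
  from order_tendstoD(1)[OF assms(1) this] show ?thesis
    using eventually_gt_at_top[of 0]
  proof eventually_elim
    case (elim n)
    then have pos: "v n > 0" by (auto simp: eln_def split: if_splits)
    then have "l - \<delta> < ln (v n) / real n" using elim by (simp add: eln_def)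
    then have "real n * (l - \<delta>) \<le> ln (v n)" using elim by (simp add: field_simps)
    then show ?case using pos by (simp add: ln_ge_iff)
  qed
qed

lemma eln_rate_upper:
  assumes "(\<lambda>n. eln (v n) / ereal (real n)) \<longlonglongrightarrow> ereal l" and "\<delta> > 0"
  shows "\<forall>\<^sub>F n in sequentially. v n \<le> exp (real n * (l + \<delta>))"
proof -
  have "ereal l < ereal (l + \<delta>)" using assms by simp
  from order_tendstoD(2)[OF assms(1) this] show ?thesis
    using eventually_gt_at_top[of 0]
  proof eventually_elim
    case (elim n)
    show ?case
    proof (cases "v n > 0")
      case True
      then have "ln (v n) / real n < l + \<delta>" using elim by (simp add: eln_def)
      then have "ln (v n) \<le> real n * (l + \<delta>)" using elim by (simp add: field_simps)
      then have "exp (ln (v n)) \<le> exp (real n * (l + \<delta>))" by simp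
      then show ?thesis using True by simp
    next
      case False
      then show ?thesis by (smt (verit) exp_gt_zero)
    qed
  qed
qed

lemma exp_bcontfun_add: "exp_bcontfun (f + g) = exp_bcontfun f * exp_bcontfun g"
  by (rule bcontfun_eqI) (simp add: exp_add)

lemma exp_bcontfun_zero: "exp_bcontfun 0 = 1"
  by (rule bcontfun_eqI) simp


section \<open>Birkhoff sums and the deviation bound\<close>

context phase_space_flow
begin

section \<open>Koopman operator and covariance on all of C(X)\<close>

definition koopman :: "('x \<Rightarrow>\<^sub>C real) \<Rightarrow> ('x \<Rightarrow>\<^sub>C real)" where
  "koopman f = Bcontfun (\<lambda>x. apply_bcontfun f (\<alpha> x))"

lemma apply_koopman [simp]: "apply_bcontfun (koopman f) x = apply_bcontfun f (\<alpha> x)"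
proof -
  have "(\<lambda>x. apply_bcontfun f (\<alpha> x)) \<in> bcontfun"
  proof (rule bcontfun_normI)
    show "continuous_on UNIV (\<lambda>x. apply_bcontfun f (\<alpha> x))"
      by (rule continuous_on_compose2[OF continuous_on_apply_bcontfun \<alpha>_continuous]) auto
    show "norm (apply_bcontfun f (\<alpha> x)) \<le> norm f" for x
      by (rule norm_bounded)
  qed
  then show ?thesis by (simp add: koopman_def Bcontfun_inverse)
qed

lemma koopman_exp: "koopman (exp_bcontfun f) = exp_bcontfun (koopman f)"
  by (rule bcontfun_eqI) simp

lemma bounded_linear_koopman: "bounded_linear koopman"
proof (rule bounded_linear_intro[where K = 1])
  show "norm (koopman f) \<le> norm f * 1" for f
  proof (rule norm_bound)
    show "norm (apply_bcontfun (koopman f) x) \<le> norm f * 1" for x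
      using norm_bounded[of f "\<alpha> x"] by simp
  qed
qed (auto intro: bcontfun_eqI)

text \<open>The flow axiom covers only \<open>C\<close>. Both sides depend continuously on
  \<open>f\<close> and agree on the dense image of \<open>C\<close>, hence everywhere; this is
  needed since exponentials need not lie in that image.\<close>

lemma covariance_J: "E * J f = J (koopman f) * E"
proof -
  let ?S = "{f. E * J f = J (koopman f) * E}"
  have "closed ?S"
    by (intro closed_Collect_eq continuous_intros
        bounded_linear.continuous_on[OF J_bounded_linear]
        bounded_linear.continuous_on[OF bounded_linear_koopman])
  moreover have "\<iota> ` C \<subseteq> ?S"
  proof safe
    fix a assume a: "a \<in> C"
    have "koopman (\<iota> a) = \<iota> (\<alpha>s a)"
      by (rule bcontfun_eqI) (simp add: \<alpha>_dual a)
    then show "E * J (\<iota> a) = J (koopman (\<iota> a)) * E"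
      using a covariance[of a] by (simp add: J_extends \<alpha>s_C)
  qed
  ultimately have "closure (\<iota> ` C) \<subseteq> ?S" by (simp add: closure_minimal)
  then show ?thesis using \<iota>_dense by auto
qed

lemma J_one: "J 1 = 1"
  using J_extends[OF one_C] \<iota>_one by simp

lemma J_commute: "J f * J g = J g * J f"
proof -
  have "f * g = g * f" by (rule bcontfun_eqI) simp
  then show ?thesis by (simp flip: J_mult)
qed

text \<open>The extra weight does no harm because the images of functions under \<open>J\<close>
  commute.\<close>

lemma weighted_covariance: "weighted J E \<phi> * J f = J (koopman f) * weighted J E \<phi>"
proof -
  have "weighted J E \<phi> * J f = J (exp_bcontfun \<phi>) * (E * J f)"
    by (simp add: weighted_def mult.assoc)
  also have "\<dots> = J (exp_bcontfun \<phi>) * J (koopman f) * E"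
    by (simp add: covariance_J mult.assoc)
  also have "\<dots> = J (koopman f) * weighted J E \<phi>"
    by (simp only: weighted_def J_commute[of "exp_bcontfun \<phi>" "koopman f"] mult.assoc)
  finally show ?thesis .
qed

lemma weighted_add: "weighted J E (\<phi> + f) = J (exp_bcontfun f) * weighted J E \<phi>"
  unfolding weighted_def exp_bcontfun_add J_mult by (simp add: J_commute flip: mult.assoc)

section \<open>Birkhoff sums and powers of the weighted element\<close>

primrec birkhoff_sum :: "('x \<Rightarrow>\<^sub>C real) \<Rightarrow> nat \<Rightarrow> ('x \<Rightarrow>\<^sub>C real)" where
  "birkhoff_sum f 0 = 0"
| "birkhoff_sum f (Suc n) = f + koopman (birkhoff_sum f n)"

lemma apply_birkhoff_sum:
  "apply_bcontfun (birkhoff_sum f n) x = (\<Sum>i<n. apply_bcontfun f ((\<alpha> ^^ i) x))"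
proof (induction n arbitrary: x)
  case (Suc n)
  then show ?case
    by (simp add: sum.lessThan_Suc_shift funpow_swap1 del: sum.lessThan_Suc)
qed simp

lemma birkhoff_sum_eq_empirical:
  "n > 0 \<Longrightarrow> apply_bcontfun (birkhoff_sum f n) x = real n * empirical \<alpha> x n f"
  by (simp add: apply_birkhoff_sum empirical_def)

lemma birkhoff_sum_scaleR: "birkhoff_sum (t *\<^sub>R f) n = t *\<^sub>R birkhoff_sum f n"
  by (rule bcontfun_eqI) (simp add: apply_birkhoff_sum sum_distrib_left)

text \<open>Moving one factor \<open>weighted J E \<phi>\<close> to the right past the exponential
  of a Birkhoff sum composes that sum with \<alpha>; the exponential of \<open>f\<close> left in
  front supplies the new first summand.\<close>

lemma weighted_power_add:
  "weighted J E (\<phi> + f) ^ n = J (exp_bcontfun (birkhoff_sum f n)) * weighted J E \<phi> ^ n"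
proof (induction n)
  case 0
  show ?case by (simp add: exp_bcontfun_zero J_one)
next
  case (Suc n)
  have "weighted J E (\<phi> + f) ^ Suc n
      = J (exp_bcontfun f) * (weighted J E \<phi> * J (exp_bcontfun (birkhoff_sum f n)))
        * weighted J E \<phi> ^ n"
    by (simp only: power_Suc Suc.IH) (simp only: weighted_add mult.assoc)
  also have "\<dots> = J (exp_bcontfun (birkhoff_sum f (Suc n))) * weighted J E \<phi> ^ Suc n"
    by (simp add: weighted_covariance koopman_exp exp_bcontfun_add J_mult mult.assoc)
  finally show ?case .
qed

lemma continuous_empirical: "continuous_on UNIV (\<lambda>x. empirical \<alpha> x n f)"
proof -
  have "(\<lambda>x. empirical \<alpha> x n f) = (\<lambda>x. inverse (real n) * apply_bcontfun (birkhoff_sum f n) x)"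
    by (simp add: apply_birkhoff_sum empirical_def divide_inverse mult.commute)
  then show ?thesis
    by (simp only:) (intro continuous_on_mult continuous_on_const continuous_on_apply_bcontfun)
qed

text \<open>The normalization \<open>c\<close> covers both \<open>P\<^sub>n\<close> (\<open>c = 1\<close>) and, for an eigen-state, \<open>\<nu>\<close> itself
  (\<open>c = \<nu> 1\<close>).\<close>

definition tilted_measure ::
    "('a \<Rightarrow> real) \<Rightarrow> ('x \<Rightarrow>\<^sub>C real) \<Rightarrow> nat \<Rightarrow> real \<Rightarrow> 'x measure \<Rightarrow> bool" where
  "tilted_measure \<nu> \<phi> n c M \<longleftrightarrow> sets M = sets borel \<and> finite_measure M \<and>
    (\<forall>g. (\<integral>x. apply_bcontfun g x \<partial>M) =
      c * (\<nu> (J g * weighted J E \<phi> ^ n) / \<nu> (weighted J E \<phi> ^ n)))"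

text \<open>An exponential Markov bound. The measure and \<open>c\<close> are quantified inside the
  eventuality, so that the threshold for \<open>n\<close> and the constants are common to all of
  them.\<close>

lemma upper_deviation_bound:
  assumes fin: "\<And>\<psi>. \<bar>spectral_potential J E \<psi>\<bar> \<noteq> \<infinity>"
    and der: "has_gateaux_derivative (\<lambda>\<psi>. real_of_ereal (spectral_potential J E \<psi>)) \<mu> \<phi>"
    and sens: "sensitive_state J E P \<phi> \<nu>"
    and \<epsilon>: "\<epsilon> > 0"
  obtains K \<delta> where "K > 0" "\<delta> > 0"
    "\<forall>\<^sub>F n in sequentially. \<forall>c M. c \<ge> 0 \<longrightarrow> tilted_measure \<nu> \<phi> n c M \<longrightarrow>
      measure M {x. empirical \<alpha> x n f > \<mu> f + \<epsilon>} \<le> c * K * exp (- \<delta> * real n)"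
proof -
  define \<Lambda> where "\<Lambda> t = real_of_ereal (spectral_potential J E (\<phi> + t *\<^sub>R f))" for t
  have \<Lambda>: "spectral_potential J E (\<phi> + t *\<^sub>R f) = ereal (\<Lambda> t)" for t
    unfolding \<Lambda>_def using fin by (simp add: ereal_real')
  have "(\<Lambda> has_real_derivative \<mu> f) (at 0)"
    using der unfolding has_gateaux_derivative_def \<Lambda>_def by blast
  then have "((\<lambda>t. (\<Lambda> t - \<Lambda> 0) / t) \<longlongrightarrow> \<mu> f) (at 0)"
    by (simp add: DERIV_def)
  then have "\<forall>\<^sub>F t in at 0. (\<Lambda> t - \<Lambda> 0) / t < \<mu> f + \<epsilon>"
    using \<epsilon> by (intro order_tendstoD(2)) auto
  \<comment> \<open>Markov's inequality for the exponential of \<open>t\<close> times the Birkhoff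
    sum needs \<open>t > 0\<close>, so only the right-hand side of the derivative is kept.\<close>
  then have "\<forall>\<^sub>F t in at_right 0. (\<Lambda> t - \<Lambda> 0) / t < \<mu> f + \<epsilon>"
    by (simp add: eventually_at_split)
  moreover have "\<forall>\<^sub>F t in at_right 0. (0::real) < t"
    by (rule eventually_at_right_less)
  ultimately have "\<forall>\<^sub>F t in at_right 0. 0 < t \<and> (\<Lambda> t - \<Lambda> 0) / t < \<mu> f + \<epsilon>"
    by eventually_elim simp
  then obtain t where t: "t > 0" "(\<Lambda> t - \<Lambda> 0) / t < \<mu> f + \<epsilon>"
    using eventually_happens[of _ "at_right (0::real)"] by auto
  \<comment> \<open>The gap in the numerator is positive by the choice of \<open>t\<close>. One
    third is spent on the lower growth estimate, one on the upper, and the last remains as the decay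
    rate.\<close>
  define \<delta> where "\<delta> = (t * (\<mu> f + \<epsilon>) - (\<Lambda> t - \<Lambda> 0)) / 3"
  have \<delta>: "\<delta> > 0" using t by (simp add: \<delta>_def field_simps)
  let ?w = "weighted J E \<phi>" and ?wt = "weighted J E (\<phi> + t *\<^sub>R f)"
  have bl: "bounded_linear \<nu>" using sens by (simp add: sensitive_state_def state_def)
  obtain K where K: "K > 0" "\<And>a. \<bar>\<nu> a\<bar> \<le> norm a * K"
    using bounded_linear.pos_bounded[OF bl] by auto
  have low: "\<forall>\<^sub>F n in sequentially. exp (real n * (\<Lambda> 0 - \<delta>)) \<le> \<nu> (?w ^ n)"
    using sens \<Lambda>[of 0] \<delta> by (intro eln_rate_lower) (auto simp: sensitive_state_def)
  \<comment> \<open>Sensitivity is assumed only at \<phi>. At the perturbed potential the norm gives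
    an upper rate, and boundedness of \<nu> transfers it at the cost of the factor
    \<open>K\<close>.\<close>
  have upp: "\<forall>\<^sub>F n in sequentially. norm (?wt ^ n) \<le> exp (real n * (\<Lambda> t + \<delta>))"
    using spectral_potential_tendsto[of J E "\<phi> + t *\<^sub>R f"] \<Lambda>[of t] \<delta>
    by (intro eln_rate_upper) auto
  have "\<forall>\<^sub>F n in sequentially. \<forall>c M. c \<ge> 0 \<longrightarrow> tilted_measure \<nu> \<phi> n c M \<longrightarrow>
      measure M {x. empirical \<alpha> x n f > \<mu> f + \<epsilon>} \<le> c * K * exp (- \<delta> * real n)"
    using low upp eventually_gt_at_top[of 0]
  proof eventually_elim
    case (elim n)
    show ?case
    proof (intro allI impI)
      fix c M assume c: "(c::real) \<ge> 0" and M: "tilted_measure \<nu> \<phi> n c M"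
      interpret finite_measure M using M by (simp add: tilted_measure_def)
      have sets [measurable_cong]: "sets M = sets borel" using M by (simp add: tilted_measure_def)
      have sp: "space M = UNIV" using sets_eq_imp_space_eq[OF sets] by simp
      define g where "g = exp_bcontfun (t *\<^sub>R birkhoff_sum f n)"
      define b where "b = exp (real n * (t * (\<mu> f + \<epsilon>)))"
      have "apply_bcontfun g \<in> borel_measurable borel"
        by (intro borel_measurable_continuous_onI) simp
      then have gm: "apply_bcontfun g \<in> borel_measurable M"
        using sets by (simp cong: measurable_cong_sets)
      have gint: "integrable M (apply_bcontfun g)"
        using gm norm_bounded[of g] by (intro integrable_const_bound[where B = "norm g"]) auto
      have "{x. empirical \<alpha> x n f > \<mu> f + \<epsilon>} \<subseteq> {x \<in> space M. apply_bcontfun g x \<ge> b}"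
        using elim(3) t(1)
        by (auto simp: sp g_def b_def birkhoff_sum_eq_empirical intro!: mult_left_mono)
      moreover have "{x \<in> space M. apply_bcontfun g x \<ge> b} \<in> sets M"
        using gm by measurable
      ultimately have "measure M {x. empirical \<alpha> x n f > \<mu> f + \<epsilon>}
          \<le> measure M {x \<in> space M. apply_bcontfun g x \<ge> b}"
        by (intro finite_measure_mono) auto
      also have "\<dots> \<le> (\<integral>x. apply_bcontfun g x \<partial>M) / b"
        by (rule integral_Markov_inequality_measure[OF gint, where A = "{}"])
           (auto simp: g_def b_def)
      also have "(\<integral>x. apply_bcontfun g x \<partial>M) = c * (\<nu> (?wt ^ n) / \<nu> (?w ^ n))"
        using M unfolding tilted_measure_def g_def weighted_power_add birkhoff_sum_scaleR by blast
      \<comment> \<open>The ratio is estimated from above by enlarging the numerator via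
        \<open>upp\<close> and shrinking the denominator to its positive lower bound from
        \<open>low\<close>.\<close>
      also have "\<dots> / b \<le>
          c * ((exp (real n * (\<Lambda> t + \<delta>)) * K) / exp (real n * (\<Lambda> 0 - \<delta>))) / b"
      proof (intro divide_right_mono mult_left_mono frac_le c)
        show "\<nu> (?wt ^ n) \<le> exp (real n * (\<Lambda> t + \<delta>)) * K"
          using K(2)[of "?wt ^ n"] mult_right_mono[OF elim(2), of K] K(1) by linarith
      qed (use elim K(1) in \<open>auto simp: b_def\<close>)
      also have "\<dots> = c * K * exp (real n * (\<Lambda> t + \<delta>) - real n * (\<Lambda> 0 - \<delta>)
          - real n * (t * (\<mu> f + \<epsilon>)))"
        unfolding b_def by (simp add: exp_diff)
      also have "real n * (\<Lambda> t + \<delta>) - real n * (\<Lambda> 0 - \<delta>) - real n * (t * (\<mu> f + \<epsilon>))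
          = - \<delta> * real n"
        unfolding \<delta>_def by (simp add: field_simps)
      finally show "measure M {x. empirical \<alpha> x n f > \<mu> f + \<epsilon>}
          \<le> c * K * exp (- \<delta> * real n)" .
    qed
  qed
  with K(1) \<delta> show thesis by (rule that)
qed

lemma empirical_uminus: "empirical \<alpha> x n (- f) = - empirical \<alpha> x n f"
  by (simp add: empirical_def sum_negf)

text \<open>The two tails are the upper tails of \<open>f\<close> and \<open>- f\<close>; a union
  bound adds the constants and keeps the slower rate.\<close>

lemma deviation_bound:
  assumes fin: "\<And>\<psi>. \<bar>spectral_potential J E \<psi>\<bar> \<noteq> \<infinity>"
    and der: "has_gateaux_derivative (\<lambda>\<psi>. real_of_ereal (spectral_potential J E \<psi>)) \<mu> \<phi>"
    and sens: "sensitive_state J E P \<phi> \<nu>"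
    and \<epsilon>: "\<epsilon> > 0"
  obtains K \<delta> where "K > 0" "\<delta> > 0"
    "\<forall>\<^sub>F n in sequentially. \<forall>c M. c \<ge> 0 \<longrightarrow> tilted_measure \<nu> \<phi> n c M \<longrightarrow>
      measure M {x. \<bar>empirical \<alpha> x n f - \<mu> f\<bar> > \<epsilon>} \<le> c * K * exp (- \<delta> * real n)"
proof -
  have \<mu>: "\<mu> (- f) = - \<mu> f"
    using der bounded_linear.linear linear_neg unfolding has_gateaux_derivative_def by blast
  obtain K1 \<delta>1 where 1: "K1 > 0" "\<delta>1 > 0"
    "\<forall>\<^sub>F n in sequentially. \<forall>c M. c \<ge> 0 \<longrightarrow> tilted_measure \<nu> \<phi> n c M \<longrightarrow>
      measure M {x. empirical \<alpha> x n f > \<mu> f + \<epsilon>} \<le> c * K1 * exp (- \<delta>1 * real n)"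
    using upper_deviation_bound[OF fin der sens \<epsilon>, of f] .
  obtain K2 \<delta>2 where 2: "K2 > 0" "\<delta>2 > 0"
    "\<forall>\<^sub>F n in sequentially. \<forall>c M. c \<ge> 0 \<longrightarrow> tilted_measure \<nu> \<phi> n c M \<longrightarrow>
      measure M {x. empirical \<alpha> x n (- f) > \<mu> (- f) + \<epsilon>} \<le> c * K2 * exp (- \<delta>2 * real n)"
    using upper_deviation_bound[OF fin der sens \<epsilon>, of "- f"] .
  define \<delta> where "\<delta> = min \<delta>1 \<delta>2"
  have "\<forall>\<^sub>F n in sequentially. \<forall>c M. c \<ge> 0 \<longrightarrow> tilted_measure \<nu> \<phi> n c M \<longrightarrow>
      measure M {x. \<bar>empirical \<alpha> x n f - \<mu> f\<bar> > \<epsilon>} \<le> c * (K1 + K2) * exp (- \<delta> * real n)"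
    using 1(3) 2(3)
  proof eventually_elim
    case (elim n)
    show ?case
    proof (intro allI impI)
      fix c M assume c: "(c::real) \<ge> 0" and M: "tilted_measure \<nu> \<phi> n c M"
      interpret finite_measure M using M by (simp add: tilted_measure_def)
      let ?A = "{x. empirical \<alpha> x n f > \<mu> f + \<epsilon>}"
      let ?B = "{x. empirical \<alpha> x n (- f) > \<mu> (- f) + \<epsilon>}"
      have "open ?A" "open ?B"
        by (auto intro!: open_Collect_less continuous_empirical continuous_intros)
      then have AB: "?A \<in> sets M" "?B \<in> sets M"
        using M by (auto simp: tilted_measure_def)
      have "{x. \<bar>empirical \<alpha> x n f - \<mu> f\<bar> > \<epsilon>} \<subseteq> ?A \<union> ?B"
        by (auto simp: empirical_uminus \<mu>)
      then have "measure M {x. \<bar>empirical \<alpha> x n f - \<mu> f\<bar> > \<epsilon>} \<le> measure M (?A \<union> ?B)"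
        using AB by (intro finite_measure_mono) auto
      also have "\<dots> \<le> measure M ?A + measure M ?B"
        using AB by (rule measure_Un_le)
      also have "\<dots> \<le> c * K1 * exp (- \<delta>1 * real n) + c * K2 * exp (- \<delta>2 * real n)"
        using elim c M by (intro add_mono) blast+
      also have "\<dots> \<le> c * K1 * exp (- \<delta> * real n) + c * K2 * exp (- \<delta> * real n)"
        using c 1(1) 2(1) by (intro add_mono mult_left_mono) (auto simp: \<delta>_def mult_right_mono)
      also have "\<dots> = c * (K1 + K2) * exp (- \<delta> * real n)"
        by (simp add: algebra_simps)
      finally show "measure M {x. \<bar>empirical \<alpha> x n f - \<mu> f\<bar> > \<epsilon>}
          \<le> c * (K1 + K2) * exp (- \<delta> * real n)" .
    qed
  qed
  with 1 2 show thesis by (intro that[of "K1 + K2" \<delta>]) (auto simp: \<delta>_def)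
qed

text \<open>The eigen relation removes a factor at the right end, hence \<open>power_Suc2\<close>.
  The resulting scalar does not depend on \<open>a\<close> and so cancels in the ratio defining the
  tilted measures.\<close>

lemma eigen_state_power:
  assumes "right_eigen_state J E P \<phi> \<nu>"
  shows "\<nu> (a * weighted J E \<phi> ^ n) =
    exp (real_of_ereal (spectral_potential J E \<phi>)) ^ n * \<nu> a"
proof (induction n)
  case (Suc n)
  have "a * weighted J E \<phi> ^ Suc n = (a * weighted J E \<phi> ^ n) * weighted J E \<phi>"
    by (simp only: power_Suc2 mult.assoc)
  then show ?case using assms Suc by (simp add: right_eigen_state_def)
qed simp

end

lemma summable_exp_neg:
  fixes \<delta> :: real
  assumes "\<delta> > 0"
  shows "summable (\<lambda>n. exp (- \<delta> * real n))"
proof -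
  have "(\<lambda>n. exp (- \<delta> * real n)) = (\<lambda>n. exp (- \<delta>) ^ n)"
    by (simp add: exp_of_nat_mult[symmetric] mult.commute)
  then show ?thesis using assms by (simp add: summable_geometric)
qed

theorem corollary6p5:
  fixes P :: "'a::{real_normed_algebra_1, banach} set" and C :: "'a set"
    and E :: 'a and \<alpha>s :: "'a \<Rightarrow> 'a"
    and \<iota> :: "'a \<Rightarrow> ('x::t2_space \<Rightarrow>\<^sub>C real)"
    and J :: "('x \<Rightarrow>\<^sub>C real) \<Rightarrow> 'a" and \<alpha> :: "'x \<Rightarrow> 'x"
    and \<phi> :: "'x \<Rightarrow>\<^sub>C real" and \<mu> :: "('x \<Rightarrow>\<^sub>C real) \<Rightarrow> real"
    and \<nu> :: "'a \<Rightarrow> real"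
    and Pn :: "nat \<Rightarrow> 'x measure" and N :: "'x measure"
  assumes "phase_space_flow P C E \<alpha>s \<iota> J \<alpha>"
    and "\<forall>\<psi>. \<bar>spectral_potential J E \<psi>\<bar> \<noteq> \<infinity>"
    and "has_gateaux_derivative (\<lambda>\<psi>. real_of_ereal (spectral_potential J E \<psi>)) \<mu> \<phi>"
    and "sensitive_state J E P \<phi> \<nu>"
    and "\<forall>\<^sub>F n in sequentially.
      riesz_measure (Pn n) (\<lambda>g. \<nu> (J g * weighted J E \<phi> ^ n) / \<nu> (weighted J E \<phi> ^ n))"
    and "riesz_measure N (\<lambda>g. \<nu> (J g))"
  shows "(\<forall>f. \<forall>\<epsilon>>0.
      (\<lambda>n. measure (Pn n) {x. \<bar>empirical \<alpha> x n f - \<mu> f\<bar> > \<epsilon>}) \<longlonglongrightarrow> 0) \<and>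
    (right_eigen_state J E P \<phi> \<nu> \<longrightarrow>
      (\<forall>f. AE x in N. (\<lambda>n. empirical \<alpha> x n f) \<longlonglongrightarrow> \<mu> f))"
proof -
  interpret phase_space_flow P C E \<alpha>s \<iota> J \<alpha> by (rule assms(1))
  note bound = deviation_bound[OF spec[OF assms(2)] assms(3,4)]
  have weak: "(\<lambda>n. measure (Pn n) {x. \<bar>empirical \<alpha> x n f - \<mu> f\<bar> > \<epsilon>}) \<longlonglongrightarrow> 0"
    if \<epsilon>: "\<epsilon> > 0" for f \<epsilon>
  proof -
    obtain K \<delta> where K: "K > 0" "\<delta> > 0"
      "\<forall>\<^sub>F n in sequentially. \<forall>c M. c \<ge> 0 \<longrightarrow> tilted_measure \<nu> \<phi> n c M \<longrightarrow>
        measure M {x. \<bar>empirical \<alpha> x n f - \<mu> f\<bar> > \<epsilon>} \<le> c * K * exp (- \<delta> * real n)"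
      using bound[OF \<epsilon>, of f] .
    have "\<forall>\<^sub>F n in sequentially. measure (Pn n) {x. \<bar>empirical \<alpha> x n f - \<mu> f\<bar> > \<epsilon>}
        \<le> K * exp (- \<delta> * real n)"
      using K(3) assms(5)
    proof eventually_elim
      case (elim n)
      then have "tilted_measure \<nu> \<phi> n 1 (Pn n)"
        by (simp add: tilted_measure_def riesz_measure_def)
      then show ?case using elim(1)[rule_format, of 1 "Pn n"] by simp
    qed
    moreover have "(\<lambda>n. K * exp (- \<delta> * real n)) \<longlonglongrightarrow> K * 0"
      by (intro tendsto_mult tendsto_const summable_LIMSEQ_zero summable_exp_neg K)
    ultimately show ?thesis
      by - (rule tendsto_sandwich[OF _ _ tendsto_const], auto)
  qed
  have strong: "AE x in N. (\<lambda>n. empirical \<alpha> x n f) \<longlonglongrightarrow> \<mu> f"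
    if eig: "right_eigen_state J E P \<phi> \<nu>" for f
  proof -
    interpret N: finite_measure N using assms(6) by (simp add: riesz_measure_def)
    have setsN: "sets N = sets borel" using assms(6) by (simp add: riesz_measure_def)
    have \<nu>1: "\<nu> 1 \<ge> 0"
      using assms(4) one_P by (simp add: sensitive_state_def state_def)
    \<comment> \<open>If this value vanished, the eigen relation would make \<nu> vanish on every
      power of the weighted element, against the exponential lower bound that sensitivity and
      finiteness of the potential provide.\<close>
    have "\<nu> 1 \<noteq> 0"
    proof
      assume "\<nu> 1 = 0"
      then have "\<nu> (weighted J E \<phi> ^ n) = 0" for n
        using eigen_state_power[OF eig, of 1 n] by simp
      moreover obtain l where "spectral_potential J E \<phi> = ereal l"
        using assms(2) by (metis ereal_real')
      then have "(\<lambda>n. eln (\<nu> (weighted J E \<phi> ^ n)) / ereal (real n)) \<longlonglongrightarrow> ereal l"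
        using assms(4) by (simp add: sensitive_state_def)
      from eln_rate_lower[OF this zero_less_one] obtain n
        where "exp (real n * (l - 1)) \<le> \<nu> (weighted J E \<phi> ^ n)"
        by (auto simp: eventually_sequentially)
      ultimately show False by (simp add: not_le[symmetric])
    qed
    \<comment> \<open>The powers of the eigenvalue cancel and the factor \<open>\<nu> 1\<close>
      undoes the normalization, so the single measure \<open>N\<close> is tilted for every
      \<open>n\<close>.\<close>
    then have tilted: "tilted_measure \<nu> \<phi> n (\<nu> 1) N" for n
      using assms(6) eigen_state_power[OF eig, of 1 n]
      by (simp add: tilted_measure_def riesz_measure_def eigen_state_power[OF eig])
    have "AE x in N. \<forall>\<^sub>F n in sequentially. \<bar>empirical \<alpha> x n f - \<mu> f\<bar> \<le> \<epsilon>"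
      if \<epsilon>: "\<epsilon> > 0" for \<epsilon>
    proof -
      obtain K \<delta> where K: "K > 0" "\<delta> > 0"
        "\<forall>\<^sub>F n in sequentially. \<forall>c M. c \<ge> 0 \<longrightarrow> tilted_measure \<nu> \<phi> n c M \<longrightarrow>
          measure M {x. \<bar>empirical \<alpha> x n f - \<mu> f\<bar> > \<epsilon>} \<le> c * K * exp (- \<delta> * real n)"
        using bound[OF \<epsilon>, of f] .
      let ?A = "\<lambda>n. {x. \<bar>empirical \<alpha> x n f - \<mu> f\<bar> > \<epsilon>}"
      have "open (?A n)" for n
        by (intro open_Collect_less continuous_empirical continuous_intros)
      then have A: "?A n \<in> sets N" for n
        by (simp add: setsN)
      have "\<forall>\<^sub>F n in sequentially. norm (measure N (?A n)) \<le> \<nu> 1 * K * exp (- \<delta> * real n)"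
        using K(3) by eventually_elim (use tilted \<nu>1 in auto)
      moreover have "summable (\<lambda>n. \<nu> 1 * K * exp (- \<delta> * real n))"
        by (intro summable_mult summable_exp_neg K)
      ultimately have "summable (\<lambda>n. measure N (?A n))"
        by (rule summable_comparison_test_ev)
      \<comment> \<open>By Borel-Cantelli, almost every point lies in only finitely many of the
        deviation sets.\<close>
      then have "AE x in N. \<forall>\<^sub>F n in sequentially. x \<in> space N - ?A n"
        by (intro borel_cantelli_AE1 A) (simp_all add: N.emeasure_finite less_top[symmetric])
      then show ?thesis
        by (rule AE_mp) (auto intro!: AE_I2 elim!: eventually_mono)
    qed
    \<comment> \<open>The exceptional null set depends on \<epsilon>, so \<epsilon> is restricted to
      a countable sequence tending to zero before the quantifiers are exchanged.\<close>
    then have "AE x in N. \<forall>k. \<forall>\<^sub>F n in sequentially.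
        \<bar>empirical \<alpha> x n f - \<mu> f\<bar> \<le> inverse (real (Suc k))"
      by (subst AE_all_countable) simp
    then show ?thesis
    proof (rule AE_mp, intro AE_I2 impI)
      fix x assume x: "\<forall>k. \<forall>\<^sub>F n in sequentially.
        \<bar>empirical \<alpha> x n f - \<mu> f\<bar> \<le> inverse (real (Suc k))"
      show "(\<lambda>n. empirical \<alpha> x n f) \<longlonglongrightarrow> \<mu> f"
      proof (rule tendstoI)
        fix e :: real assume "e > 0"
        then obtain k where "inverse (real (Suc k)) < e" using reals_Archimedean by blast
        with x[rule_format, of k] show "\<forall>\<^sub>F n in sequentially. dist (empirical \<alpha> x n f) (\<mu> f) < e"
          by (auto simp: dist_real_def elim!: eventually_mono)
      qed
    qed
  qed
  show ?thesis using weak strong by blast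
qed

end
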